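(* Let $A\in\mathbf{R}^{n\times n}$, $C_i\in\mathbf{R}^{m_i\times n}$ ($i=1,\ldots,N$), $H\in\mathbf{R}^{p\times n}$, and let $\mathcal{L}$ be the Laplacian of a directed graph on $N$ nodes. Set $\bar A=I_N\otimes A$, $\bar C=\mathrm{diag}[C_1,\ldots,C_N]$, $\bar H=\mathcal{L}\otimes H$. Suppose the pair $\left(\begin{bmatrix}\bar C\\ \bar H\end{bmatrix},\bar A\right)$ is detectable. Then: (i) $\bigcap_{i=1}^N\mathcal{C}_i=\{0\}$; (ii) $\mathcal{O}_H\cap\mathcal{C}_i=\{0\}$ for all $i=1,\ldots,N$; (iii) $\operatorname{rank}O_H\ge\max_i\dim\mathcal{C}_i$. Here $\mathcal{C}_i$ is the undetectable subspace of $(C_i,A)$, $\mathcal{O}_H=\bigcap_{l=1}^n\operatorname{Ker}(HA^{l-1})$ is the unobservable subspace of $(H,A)$, and $O_H=[H';(HA)';\ldots;(HA^{n-1})']'$ is the observability matrix of $(H,A)$.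
   Context: Directed graph on $\{1,\ldots,N\}$ without self-loops; adjacency matrix $\mathbf{A}=[\mathbf{a}_{ij}]$ with $\mathbf{a}_{ij}=1$ if there is an edge from $j$ to $i$, else $0$; $p_i$ the in-degree of node $i$; Laplacian $\mathcal{L}=\mathrm{diag}[p_1,\ldots,p_N]-\mathbf{A}$. For a square matrix $F$ with minimal polynomial $\alpha_F=\alpha_F^-\alpha_F^+$ (zeros of $\alpha_F^-$ in the open left half-plane, of $\alpha_F^+$ in the closed right half-plane), the undetectable subspace of $(G,F)$ is $\bigcap_{l=1}^n\operatorname{Ker}(GF^{l-1})\cap\operatorname{Ker}\alpha_F^+(F)$; the pair is detectable iff this subspace is $\{0\}$. *)

theory Defs
  imports "Jordan_Normal_Form.Matrix_Kernel" "Jordan_Normal_Form.DL_Rank"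
    "HOL-Computational_Algebra.Polynomial"
begin

text \<open>Evaluation of a polynomial at a square matrix (Horner scheme):
  p(F) = c0 I + F (c1 I + F (c2 I + ...)).\<close>
definition poly_mat :: "real poly \<Rightarrow> real mat \<Rightarrow> real mat" where
  "poly_mat p F = foldr (\<lambda>c M. c \<cdot>\<^sub>m 1\<^sub>m (dim_row F) + F * M) (coeffs p) (0\<^sub>m (dim_row F) (dim_row F))"

text \<open>Minimal polynomial: the monic polynomial of least degree annihilating F.\<close>
definition min_poly :: "real mat \<Rightarrow> real poly" where
  "min_poly F = (THE p. lead_coeff p = 1 \<and> poly_mat p F = 0\<^sub>m (dim_row F) (dim_row F) \<and>
      (\<forall>q. q \<noteq> 0 \<and> poly_mat q F = 0\<^sub>m (dim_row F) (dim_row F) \<longrightarrow> degree p \<le> degree q))"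

text \<open>The factor alpha_F^+ in alpha_F = alpha_F^- alpha_F^+: zeros of alpha_F^- lie in the open left
  half-plane, zeros of alpha_F^+ in the closed right half-plane (both factors taken monic).\<close>
definition min_poly_plus :: "real mat \<Rightarrow> real poly" where
  "min_poly_plus F = (THE q. \<exists>r. min_poly F = r * q \<and> lead_coeff q = 1 \<and> lead_coeff r = 1 \<and>
      (\<forall>z. poly (map_poly complex_of_real q) z = 0 \<longrightarrow> Re z \<ge> 0) \<and>
      (\<forall>z. poly (map_poly complex_of_real r) z = 0 \<longrightarrow> Re z < 0))"

text \<open>Undetectable subspace of (G,F), F an n x n matrix.\<close>
definition undetectable_subspace :: "real mat \<Rightarrow> real mat \<Rightarrow> real vec set" where
  "undetectable_subspace G F =
     carrier_vec (dim_row F) \<inter> (\<Inter>l\<in>{1..dim_row F}. mat_kernel (G * F ^\<^sub>m (l - 1)))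
       \<inter> mat_kernel (poly_mat (min_poly_plus F) F)"

definition detectable :: "real mat \<Rightarrow> real mat \<Rightarrow> bool" where
  "detectable G F \<longleftrightarrow> undetectable_subspace G F = {0\<^sub>v (dim_row F)}"

text \<open>Unobservable subspace of (H,A).\<close>
definition unobservable_subspace :: "real mat \<Rightarrow> real mat \<Rightarrow> real vec set" where
  "unobservable_subspace H A =
     carrier_vec (dim_row A) \<inter> (\<Inter>l\<in>{1..dim_row A}. mat_kernel (H * A ^\<^sub>m (l - 1)))"

text \<open>Observability matrix [H; HA; ...; HA^(n-1)].\<close>
definition obs_matrix :: "real mat \<Rightarrow> real mat \<Rightarrow> real mat" where
  "obs_matrix H A = foldr (\<lambda>l M. (H * A ^\<^sub>m l) @\<^sub>r M) [0..<dim_row A] (0\<^sub>m 0 (dim_col H))"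

definition mat_rank :: "real mat \<Rightarrow> nat" where
  "mat_rank M = vec_space.rank (dim_row M) M"

text \<open>Dimension of a subspace W of R^n.\<close>
definition subspace_dim :: "nat \<Rightarrow> real vec set \<Rightarrow> nat" where
  "subspace_dim n W = vectorspace.dim class_ring ((module_vec TYPE(real) n)\<lparr>carrier := W\<rparr>)"

definition kron :: "real mat \<Rightarrow> real mat \<Rightarrow> real mat" where
  "kron X Y = mat (dim_row X * dim_row Y) (dim_col X * dim_col Y)
     (\<lambda>(i, j). X $$ (i div dim_row Y, j div dim_col Y) * Y $$ (i mod dim_row Y, j mod dim_col Y))"

text \<open>Directed graph on nodes 0..N-1 (0-based version of 1..N), E j i meaning an edge from j to i.
  Adjacency a_ij = 1 iff there is an edge from j to i; in-degree p_i; Laplacian diag(p) - A.\<close>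
definition adjacency :: "nat \<Rightarrow> (nat \<Rightarrow> nat \<Rightarrow> bool) \<Rightarrow> real mat" where
  "adjacency N E = mat N N (\<lambda>(i, j). if E j i then 1 else 0)"

definition in_degree :: "nat \<Rightarrow> (nat \<Rightarrow> nat \<Rightarrow> bool) \<Rightarrow> nat \<Rightarrow> nat" where
  "in_degree N E i = card {j. j < N \<and> E j i}"

definition laplacian :: "nat \<Rightarrow> (nat \<Rightarrow> nat \<Rightarrow> bool) \<Rightarrow> real mat" where
  "laplacian N E = mat_diag N (\<lambda>i. real (in_degree N E i)) - adjacency N E"

end

theory Submission
  imports Defs
begin

text \<open>A vector x of R^(N n) is a stack of N blocks x_1, ..., x_N of R^n, and the pair
  (diag(C_i) over L \<otimes> H, I_N \<otimes> A) acts blockwise; moreover I_N \<otimes> A has the minimal polynomial of A.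
  So if every x_i lies in the undetectable subspace of (C_i, A) and (L \<otimes> H)(I_N \<otimes> A)^k kills the stack
  for all k, the stack is undetectable for the network and hence zero. Equal blocks x_i = x pass the
  Laplacian because its rows sum to zero, which gives (i); the single nonzero block x with x
  unobservable for (H, A) gives (ii). By (ii) the observability matrix is injective on each
  undetectable subspace of (C_i, A), which gives (iii). Invariance of the kernels of H A^k for k < n
  under further powers comes from the stabilisation of a decreasing chain of subspaces of R^n.\<close>

section \<open>Matrices, vectors and subspaces\<close>

lemma mult_mat_vec_zero [simp]:
  "A \<in> carrier_mat nr nc \<Longrightarrow> A *\<^sub>v 0\<^sub>v nc = (0\<^sub>v nr :: 'a :: semiring_0 vec)"
  by (intro eq_vecI) (auto simp: scalar_prod_def)

lemma zero_mat_mult_vec [simp]: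
  "v \<in> carrier_vec nc \<Longrightarrow> 0\<^sub>m nr nc *\<^sub>v v = (0\<^sub>v nr :: 'a :: semiring_0 vec)"
  by (intro eq_vecI) (auto simp: scalar_prod_def)

lemma append_zero_vec [simp]: "0\<^sub>v a @\<^sub>v 0\<^sub>v b = (0\<^sub>v (a + b) :: 'a :: zero vec)"
  by (intro eq_vecI) auto

lemma mult_pow_mat_mult_vec:
  assumes A: "A \<in> carrier_mat n n" and B: "B \<in> carrier_mat q n" and x: "x \<in> carrier_vec n"
  shows "(B * A ^\<^sub>m k) *\<^sub>v x = B *\<^sub>v (A ^\<^sub>m k *\<^sub>v x)"
  by (rule assoc_mult_mat_vec[OF B pow_carrier_mat[OF A] x])

lemma smult_one_mat_mult_vec:
  assumes v: "v \<in> carrier_vec n"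
  shows "(c \<cdot>\<^sub>m 1\<^sub>m n) *\<^sub>v v = c \<cdot>\<^sub>v (v :: 'a :: comm_ring_1 vec)"
proof (rule eq_vecI)
  fix i assume "i < dim_vec (c \<cdot>\<^sub>v v)"
  with v have i: "i < n" by simp
  have "(\<Sum>j = 0..<n. c * (if j = i then 1 else 0) * v $ j) = (\<Sum>j = 0..<n. if j = i then c * v $ j else 0)"
    by (rule sum.cong) auto
  with i v show "((c \<cdot>\<^sub>m 1\<^sub>m n) *\<^sub>v v) $ i = (c \<cdot>\<^sub>v v) $ i"
    by (simp add: scalar_prod_def)
qed (use v in simp)

lemma mat_eq_zero_iff_mult_vec:
  assumes M: "M \<in> carrier_mat nr nc"
  shows "M = 0\<^sub>m nr nc \<longleftrightarrow> (\<forall>v\<in>carrier_vec nc. M *\<^sub>v v = (0\<^sub>v nr :: 'a :: semiring_1 vec))"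
proof
  assume zero: "\<forall>v\<in>carrier_vec nc. M *\<^sub>v v = 0\<^sub>v nr"
  show "M = 0\<^sub>m nr nc"
  proof (rule eq_matI)
    fix i j assume i: "i < dim_row (0\<^sub>m nr nc :: 'a mat)" and j: "j < dim_col (0\<^sub>m nr nc :: 'a mat)"
    have "M $$ (i, j) = (M *\<^sub>v unit_vec nc j) $ i" using M i j by simp
    with zero i j show "M $$ (i, j) = 0\<^sub>m nr nc $$ (i, j)" by simp
  qed (use M in auto)
qed simp

lemma (in vec_space) vec_subspaceI:
  assumes "X \<subseteq> carrier_vec n" "0\<^sub>v n \<in> X"
    "\<And>v w. v \<in> X \<Longrightarrow> w \<in> X \<Longrightarrow> v + w \<in> X"
    "\<And>c v. v \<in> X \<Longrightarrow> c \<cdot>\<^sub>v v \<in> X"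
  shows "subspace class_ring X V"
  unfolding subspace_def submodule_def using assms vectorspace_axioms module_axioms
  by (auto simp: class_ring_simps)

lemma subspace_carrier_vec:
  assumes "subspace class_ring W (module_vec TYPE(real) n)"
  shows "W \<subseteq> carrier_vec n"
proof -
  interpret vec_space "TYPE(real)" n .
  have "submodule class_ring W V" using assms by (simp add: is_module)
  then show ?thesis unfolding submodule_def by simp
qed

lemma common_kernel_subspace:
  fixes Ms :: "real mat set"
  assumes Ms: "\<forall>M\<in>Ms. dim_col M = n"
  shows "subspace class_ring {v \<in> carrier_vec n. \<forall>M\<in>Ms. M *\<^sub>v v = 0\<^sub>v (dim_row M)}
           (module_vec TYPE(real) n)" (is "subspace _ ?S _")
proof -
  interpret vec_space "TYPE(real)" n .
  have M: "M \<in> carrier_mat (dim_row M) n" if "M \<in> Ms" for M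
    using Ms that unfolding carrier_mat_def by blast
  show ?thesis
  proof (rule vec_subspaceI)
    fix v w assume v: "v \<in> ?S" and w: "w \<in> ?S"
    have "M *\<^sub>v (v + w) = 0\<^sub>v (dim_row M)" if "M \<in> Ms" for M
      using mult_add_distrib_mat_vec[OF M[OF that], of v w] v w that by simp
    then show "v + w \<in> ?S" using v w by simp
  next
    fix c v assume v: "v \<in> ?S"
    have "M *\<^sub>v (c \<cdot>\<^sub>v v) = 0\<^sub>v (dim_row M)" if "M \<in> Ms" for M
      using mult_mat_vec[OF M[OF that], of v c] v that by (auto intro: eq_vecI)
    then show "c \<cdot>\<^sub>v v \<in> ?S" using v by simp
  qed (use M in simp_all)
qed

lemma (in vec_space) fin_dim_subspace:
  assumes X: "subspace class_ring X V"
  shows "vectorspace.fin_dim class_ring (vs X)"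
proof -
  interpret X: vectorspace class_ring "vs X" using subspace_is_vs[OF X] .
  have subm: "submodule class_ring X V" using X by (simp add: is_module)
  have XC: "X \<subseteq> carrier_vec n" using subm unfolding submodule_def by simp
  let ?P = "\<lambda>S. S \<subseteq> carrier (vs X) \<and> X.lin_indpt S"
  have bound: "finite S \<and> card S \<le> n" if "?P S" for S
  proof -
    have SX: "S \<subseteq> X" using that by simp
    then have li: "lin_indpt S" using that span_li_not_depend(2)[OF SX subm] by simp
    have SC: "S \<subseteq> carrier_vec n" using SX XC by auto
    show ?thesis using li_le_dim[OF fin_dim SC li] dim_is_n by simp
  qed
  have "?P {}" by (simp add: X.lin_dep_def)
  then obtain B where B: "finite B" "maximal B ?P" using maximal_exists[of ?P n "{}", OF bound] by blast
  have "X.gen_set B" by (rule X.max_li_is_gen[OF B(2)])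
  moreover have "B \<subseteq> carrier (vs X)" using B(2) unfolding maximal_def by simp
  ultimately show ?thesis unfolding X.fin_dim_def using B(1) by blast
qed

lemma mult_mat_vec_image_subspace:
  fixes M :: "real mat"
  assumes M: "M \<in> carrier_mat r n" and W: "subspace class_ring W (module_vec TYPE(real) n)"
  shows "subspace class_ring ((*\<^sub>v) M ` W) (module_vec TYPE(real) r)"
proof -
  interpret V: vec_space "TYPE(real)" n .
  interpret R: vec_space "TYPE(real)" r .
  have subm: "submodule class_ring W V.V" using W by (simp add: V.is_module)
  have WC: "W \<subseteq> carrier_vec n" by (rule subspace_carrier_vec[OF W])
  show ?thesis
  proof (rule R.vec_subspaceI)
    show "0\<^sub>v r \<in> (*\<^sub>v) M ` W"
      using submodule.zero_closed[OF subm] M by (auto intro!: image_eqI[of _ _ "0\<^sub>v n"])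
  next
    fix v w assume "v \<in> (*\<^sub>v) M ` W" "w \<in> (*\<^sub>v) M ` W"
    then obtain x y where xy: "x \<in> W" "y \<in> W" "v = M *\<^sub>v x" "w = M *\<^sub>v y" by auto
    then have "v + w = M *\<^sub>v (x + y)" using WC M by (simp add: mult_add_distrib_mat_vec subsetD)
    moreover have "x + y \<in> W" using submodule.m_closed[OF subm xy(1,2)] by simp
    ultimately show "v + w \<in> (*\<^sub>v) M ` W" by blast
  next
    fix c v assume "v \<in> (*\<^sub>v) M ` W"
    then obtain x where x: "x \<in> W" "v = M *\<^sub>v x" by auto
    then have "c \<cdot>\<^sub>v v = M *\<^sub>v (c \<cdot>\<^sub>v x)" using WC M by (simp add: mult_mat_vec subsetD)
    moreover have "c \<cdot>\<^sub>v x \<in> W"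
      using submodule.smult_closed[OF subm _ x(1)] by (simp add: class_ring_simps)
    ultimately show "c \<cdot>\<^sub>v v \<in> (*\<^sub>v) M ` W" by blast
  qed (use M WC in auto)
qed

lemma mult_mat_vec_linear_map:
  fixes M :: "real mat"
  assumes M: "M \<in> carrier_mat r n" and W: "subspace class_ring W (module_vec TYPE(real) n)"
  shows "linear_map class_ring ((module_vec TYPE(real) n)\<lparr>carrier := W\<rparr>)
           ((module_vec TYPE(real) r)\<lparr>carrier := (*\<^sub>v) M ` W\<rparr>) ((*\<^sub>v) M)"
proof -
  interpret V: vec_space "TYPE(real)" n .
  interpret R: vec_space "TYPE(real)" r .
  interpret VW: vectorspace class_ring "V.vs W" using V.subspace_is_vs[OF W] .
  interpret VI: vectorspace class_ring "R.vs ((*\<^sub>v) M ` W)"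
    using R.subspace_is_vs[OF mult_mat_vec_image_subspace[OF M W]] .
  have WC: "W \<subseteq> carrier_vec n" by (rule subspace_carrier_vec[OF W])
  have "(*\<^sub>v) M \<in> LinearCombinations.module_hom class_ring (V.vs W) (R.vs ((*\<^sub>v) M ` W))"
    unfolding LinearCombinations.module_hom_def
    using WC M by (auto simp: mult_add_distrib_mat_vec mult_mat_vec subsetD)
  then show ?thesis
    unfolding linear_map_def mod_hom_def mod_hom_axioms_def
    using VW.vectorspace_axioms VI.vectorspace_axioms by (simp add: vectorspace_def)
qed

lemma subspace_dim_le_rank:
  fixes M :: "real mat"
  assumes M: "M \<in> carrier_mat r n" and W: "subspace class_ring W (module_vec TYPE(real) n)"
    and inj: "\<forall>x\<in>W. M *\<^sub>v x = 0\<^sub>v r \<longrightarrow> x = 0\<^sub>v n"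
  shows "subspace_dim n W \<le> mat_rank M"
proof -
  interpret V: vec_space "TYPE(real)" n .
  interpret R: vec_space "TYPE(real)" r .
  let ?I = "(*\<^sub>v) M ` W"
  have I: "subspace class_ring ?I R.V" by (rule mult_mat_vec_image_subspace[OF M W])
  interpret L: linear_map class_ring "V.vs W" "R.vs ?I" "(*\<^sub>v) M"
    by (rule mult_mat_vec_linear_map[OF M W])
  have WC: "W \<subseteq> carrier_vec n" by (rule subspace_carrier_vec[OF W])
  have "inj_on ((*\<^sub>v) M) W"
  proof (rule inj_onI)
    fix x y assume x: "x \<in> W" and y: "y \<in> W" and eq: "M *\<^sub>v x = M *\<^sub>v y"
    have xy: "x \<in> carrier_vec n" "y \<in> carrier_vec n" using x y WC by auto
    have subm: "submodule class_ring W V.V" using W by (simp add: V.is_module)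
    have "x + (-1) \<cdot>\<^sub>v y \<in> W"
      using submodule.m_closed[OF subm x submodule.smult_closed[OF subm _ y]]
      by (simp add: class_ring_simps)
    moreover have "x + (-1) \<cdot>\<^sub>v y = x - y" using xy by (intro eq_vecI) auto
    ultimately have "x - y \<in> W" by simp
    moreover have "M *\<^sub>v (x - y) = 0\<^sub>v r"
      using eq M xy by (simp add: mult_minus_distrib_mat_vec)
    ultimately have "x - y = 0\<^sub>v n" using inj by blast
    show "x = y"
    proof (rule eq_vecI)
      fix i assume "i < dim_vec y"
      then show "x $ i = y $ i"
        using arg_cong[OF \<open>x - y = 0\<^sub>v n\<close>, of "\<lambda>v. v $ i"] xy by simp
    qed (use xy in simp)
  qed
  then have dim_eq: "L.V.dim = L.W.dim" using L.dim_eq V.fin_dim_subspace[OF W] by simp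
  have fin_dim_I: "L.W.fin_dim" using L.surj_fin_dim V.fin_dim_subspace[OF W] by simp
  have cols: "set (cols M) \<subseteq> carrier_vec r" using M cols_dim by blast
  let ?S = "R.span (set (cols M))"
  have S: "subspace class_ring ?S R.V" by (rule R.span_is_subspace[OF cols])
  have "?I \<subseteq> ?S"
    using R.col_space_eq[OF M] M WC unfolding R.col_space_def by auto
  then have nested: "subspace class_ring ?I (R.vs ?S)" by (rule R.nested_subspaces[OF S I])
  interpret VS: vectorspace class_ring "R.vs ?S" using R.subspace_is_vs[OF S] .
  have "L.W.dim \<le> VS.dim"
    using VS.subspace_dim[OF nested R.fin_dim_span_cols[OF M]] fin_dim_I by simp
  moreover have "VS.dim = R.rank M" unfolding R.rank_def ..
  ultimately show ?thesis
    using dim_eq M unfolding subspace_dim_def mat_rank_def by simp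
qed

section \<open>Krylov kernels\<close>

definition krylov_kernel :: "nat \<Rightarrow> real mat \<Rightarrow> real mat \<Rightarrow> nat \<Rightarrow> real vec set" where
  "krylov_kernel n B A j = {v \<in> carrier_vec n. \<forall>k<j. B *\<^sub>v (A ^\<^sub>m k *\<^sub>v v) = 0\<^sub>v (dim_row B)}"

lemma krylov_kernel_subspace:
  assumes A: "A \<in> carrier_mat n n" and B: "B \<in> carrier_mat q n"
  shows "subspace class_ring (krylov_kernel n B A j) (module_vec TYPE(real) n)"
proof -
  let ?Ms = "(\<lambda>k. B * A ^\<^sub>m k) ` {..<j}"
  have "(B * A ^\<^sub>m k) *\<^sub>v v = B *\<^sub>v (A ^\<^sub>m k *\<^sub>v v)" if "v \<in> carrier_vec n" for k v
    by (rule mult_pow_mat_mult_vec[OF A B that])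
  then have eq: "krylov_kernel n B A j = {v \<in> carrier_vec n. \<forall>M\<in>?Ms. M *\<^sub>v v = 0\<^sub>v (dim_row M)}"
    using B unfolding krylov_kernel_def by auto
  have "\<forall>M\<in>?Ms. dim_col M = n" using A B by auto
  then show ?thesis unfolding eq by (rule common_kernel_subspace)
qed

lemma krylov_kernel_antimono: "j \<le> j' \<Longrightarrow> krylov_kernel n B A j' \<subseteq> krylov_kernel n B A j"
  unfolding krylov_kernel_def by auto

lemma krylov_kernel_Suc:
  assumes A: "A \<in> carrier_mat n n"
  shows "v \<in> krylov_kernel n B A (Suc j) \<longleftrightarrow>
    v \<in> carrier_vec n \<and> B *\<^sub>v v = 0\<^sub>v (dim_row B) \<and> A *\<^sub>v v \<in> krylov_kernel n B A j"
proof -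
  have "A ^\<^sub>m Suc k *\<^sub>v v = A ^\<^sub>m k *\<^sub>v (A *\<^sub>v v)" if "v \<in> carrier_vec n" for k
    using A that by (simp add: assoc_mult_mat_vec[of _ n n A n])
  then show ?thesis
    using A unfolding krylov_kernel_def All_less_Suc2 by (auto simp del: pow_mat.simps(2))
qed

lemma krylov_kernel_Suc_cong:
  assumes A: "A \<in> carrier_mat n n" and eq: "krylov_kernel n B A j = krylov_kernel n B A j'"
  shows "krylov_kernel n B A (Suc j) = krylov_kernel n B A (Suc j')"
  using eq by (simp add: set_eq_iff krylov_kernel_Suc[OF A])

lemma krylov_kernel_stable:
  assumes A: "A \<in> carrier_mat n n" and eq: "krylov_kernel n B A j = krylov_kernel n B A (Suc j)"
  shows "krylov_kernel n B A (j + t) = krylov_kernel n B A j"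
proof -
  have "krylov_kernel n B A (j + t) = krylov_kernel n B A j \<and>
        krylov_kernel n B A (Suc (j + t)) = krylov_kernel n B A j"
  proof (induction t)
    case (Suc t)
    then have "krylov_kernel n B A (Suc (Suc (j + t))) = krylov_kernel n B A (Suc (j + t))"
      by (intro krylov_kernel_Suc_cong[OF A]) simp
    with Suc show ?case by simp
  qed (use eq in simp)
  then show ?thesis ..
qed

text \<open>A strictly decreasing chain of length n + 1 of subspaces of R^n would yield n + 1
  linearly independent vectors.\<close>
lemma krylov_kernel_stabilizes:
  assumes A: "A \<in> carrier_mat n n" and B: "B \<in> carrier_mat q n"
  shows "\<exists>j\<le>n. krylov_kernel n B A j = krylov_kernel n B A (Suc j)"
proof (rule ccontr)
  interpret vec_space "TYPE(real)" n .
  let ?K = "krylov_kernel n B A"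
  assume "\<not> ?thesis"
  then have "\<exists>v. v \<in> ?K j \<and> v \<notin> ?K (Suc j)" if "j \<le> n" for j
    using that krylov_kernel_antimono[of j "Suc j" n B A] by auto
  then obtain v where v: "\<And>j. j \<le> n \<Longrightarrow> v j \<in> ?K j \<and> v j \<notin> ?K (Suc j)" by metis
  have sub: "\<And>j. submodule class_ring (?K j) V"
    using krylov_kernel_subspace[OF A B] by (simp add: is_module)
  have KC: "\<And>j. ?K j \<subseteq> carrier_vec n" unfolding krylov_kernel_def by auto
  have chain: "lin_indpt (v ` {s..n}) \<and> v ` {s..n} \<subseteq> ?K s \<and> card (v ` {s..n}) = Suc n - s"
    if "s \<le> Suc n" for s
    using that
  proof (induction s rule: inc_induct)
    case (step s)
    then have sn: "s \<le> n" by simp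
    have split: "v ` {s..n} = insert (v s) (v ` {Suc s..n})"
      using sn by (auto simp: atLeastAtMost_insertL[symmetric])
    have tail: "v ` {Suc s..n} \<subseteq> ?K (Suc s)" using step.IH by simp
    have "v s \<notin> span (v ` {Suc s..n})"
      using v[OF sn] span_is_subset[OF tail sub] by blast
    moreover have "v s \<notin> v ` {Suc s..n}" using v[OF sn] tail by blast
    moreover have "v s \<in> carrier_vec n" using v[OF sn] KC by blast
    moreover have "v ` {Suc s..n} \<subseteq> carrier_vec n" using tail KC by blast
    ultimately have "lin_indpt (insert (v s) (v ` {Suc s..n}))"
      using lin_dep_iff_in_span[of "v ` {Suc s..n}" "v s"] step.IH by auto
    moreover have "v ` {s..n} \<subseteq> ?K s"
      using split tail v[OF sn] krylov_kernel_antimono[of s "Suc s" n B A] by auto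
    ultimately show ?case using split step.IH sn \<open>v s \<notin> v ` {Suc s..n}\<close> by simp
  qed (simp add: lin_dep_def)
  from chain[of 0] have "lin_indpt (v ` {0..n})" "v ` {0..n} \<subseteq> carrier_vec n"
    and card: "card (v ` {0..n}) = Suc n" using KC by auto
  then have "card (v ` {0..n}) \<le> dim" using li_le_dim(2)[OF fin_dim] by blast
  with card dim_is_n show False by simp
qed

lemma krylov_kernel_dim_subset:
  assumes A: "A \<in> carrier_mat n n" and B: "B \<in> carrier_mat q n"
  shows "krylov_kernel n B A n \<subseteq> krylov_kernel n B A j"
proof -
  obtain j0 where j0: "j0 \<le> n" "krylov_kernel n B A j0 = krylov_kernel n B A (Suc j0)"
    using krylov_kernel_stabilizes[OF A B] by blast
  have "krylov_kernel n B A n = krylov_kernel n B A (j0 + j)"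
    using krylov_kernel_stable[OF A j0(2), of "n - j0"] krylov_kernel_stable[OF A j0(2), of j] j0(1)
    by simp
  also have "\<dots> \<subseteq> krylov_kernel n B A j" by (rule krylov_kernel_antimono) simp
  finally show ?thesis .
qed

section \<open>Block vectors and Kronecker products\<close>

text \<open>Block j of block_vec N n f occupies the entries j n, ..., j n + n - 1, matching the index
  layout of kron.\<close>
definition block_vec :: "nat \<Rightarrow> nat \<Rightarrow> (nat \<Rightarrow> real vec) \<Rightarrow> real vec" where
  "block_vec N n f = vec (N * n) (\<lambda>c. f (c div n) $ (c mod n))"

lemma block_vec_carrier [simp]: "block_vec N n f \<in> carrier_vec (N * n)"
  unfolding block_vec_def by simp

lemma dim_block_vec [simp]: "dim_vec (block_vec N n f) = N * n"
  unfolding block_vec_def by simp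

lemma index_block_vec: "c < N * n \<Longrightarrow> block_vec N n f $ c = f (c div n) $ (c mod n)"
  unfolding block_vec_def by simp

lemma block_index_bounds:
  fixes c N n :: nat
  assumes "c < N * n"
  shows "c div n < N" "c mod n < n"
proof -
  show "c div n < N" using assms by (rule less_mult_imp_div_less)
  have "n > 0" using assms by (cases n) auto
  then show "c mod n < n" by simp
qed

lemma block_index_less:
  fixes j N r n :: nat
  assumes "j < N" "r < n"
  shows "j * n + r < N * n"
proof -
  have "j * n + r < Suc j * n" using assms(2) by simp
  also have "\<dots> \<le> N * n" using assms(1) by (intro mult_le_mono1) simp
  finally show ?thesis .
qed

lemma index_block_vec_block: "j < N \<Longrightarrow> r < n \<Longrightarrow> block_vec N n f $ (j * n + r) = f j $ r"
  by (simp add: index_block_vec block_index_less)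

lemma block_vec_cong: "(\<And>j. j < N \<Longrightarrow> f j = g j) \<Longrightarrow> block_vec N n f = block_vec N n g"
  unfolding block_vec_def by (intro eq_vecI) (auto simp: block_index_bounds)

lemma block_vec_zero [simp]: "block_vec N n (\<lambda>j. 0\<^sub>v n) = 0\<^sub>v (N * n)"
  by (intro eq_vecI) (auto simp: index_block_vec block_index_bounds)

lemma block_vec_eq_zero_iff:
  assumes f: "\<And>j. j < N \<Longrightarrow> f j \<in> carrier_vec n"
  shows "block_vec N n f = 0\<^sub>v (N * n) \<longleftrightarrow> (\<forall>j<N. f j = 0\<^sub>v n)"
proof
  assume zero: "block_vec N n f = 0\<^sub>v (N * n)"
  show "\<forall>j<N. f j = 0\<^sub>v n"
  proof (intro allI impI eq_vecI)
    fix j r assume j: "j < N" and "r < dim_vec (0\<^sub>v n :: real vec)"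
    then have "r < n" by simp
    then show "f j $ r = 0\<^sub>v n $ r"
      using arg_cong[OF zero, of "\<lambda>v. v $ (j * n + r)"] j
      by (simp add: index_block_vec_block block_index_less)
  qed (use f in simp)
next
  assume "\<forall>j<N. f j = 0\<^sub>v n"
  then show "block_vec N n f = 0\<^sub>v (N * n)"
    by (intro eq_vecI) (auto simp: index_block_vec block_index_bounds)
qed

lemma block_vec_blocks:
  assumes v: "v \<in> carrier_vec (N * n)"
  shows "block_vec N n (\<lambda>j. vec n (\<lambda>r. v $ (j * n + r))) = v"
  using v by (intro eq_vecI) (auto simp: index_block_vec block_index_bounds)

lemma block_vec_add_smult:
  assumes f: "\<And>j. j < N \<Longrightarrow> f j \<in> carrier_vec n" and g: "\<And>j. j < N \<Longrightarrow> g j \<in> carrier_vec n"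
  shows "block_vec N n (\<lambda>j. c \<cdot>\<^sub>v f j + g j) = c \<cdot>\<^sub>v block_vec N n f + block_vec N n g"
proof (rule eq_vecI)
  fix i assume "i < dim_vec (c \<cdot>\<^sub>v block_vec N n f + block_vec N n g)"
  then have i: "i < N * n" by simp
  with f[of "i div n"] g[of "i div n"] show
    "block_vec N n (\<lambda>j. c \<cdot>\<^sub>v f j + g j) $ i = (c \<cdot>\<^sub>v block_vec N n f + block_vec N n g) $ i"
    by (simp add: index_block_vec block_index_bounds)
qed simp

lemma block_vec_Suc:
  assumes "f 0 \<in> carrier_vec n"
  shows "block_vec (Suc N) n f = f 0 @\<^sub>v block_vec N n (\<lambda>j. f (Suc j))"
proof (rule eq_vecI)
  fix c assume "c < dim_vec (f 0 @\<^sub>v block_vec N n (\<lambda>j. f (Suc j)))"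
  then have c: "c < n + N * n" using assms by simp
  show "block_vec (Suc N) n f $ c = (f 0 @\<^sub>v block_vec N n (\<lambda>j. f (Suc j))) $ c"
  proof (cases "c < n")
    case False
    then have "n > 0" using c by (cases n) auto
    with False have "c div n = Suc ((c - n) div n)" "c mod n = (c - n) mod n"
      by (simp_all add: le_div_geq le_mod_geq)
    with c False assms show ?thesis by (simp add: index_block_vec)
  qed (use c assms in \<open>simp add: index_block_vec\<close>)
qed (use assms in simp)

lemma sum_div_mod_lessThan:
  fixes g :: "nat \<Rightarrow> nat \<Rightarrow> 'a :: comm_monoid_add"
  shows "(\<Sum>c<N * n. g (c div n) (c mod n)) = (\<Sum>j<N. \<Sum>r<n. g j r)"
proof (induction N)
  case (Suc N)
  have "(\<Sum>c<Suc N * n. g (c div n) (c mod n))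
      = (\<Sum>c<N * n. g (c div n) (c mod n)) + (\<Sum>c\<in>{N * n..<N * n + n}. g (c div n) (c mod n))"
    by (simp add: add.commute lessThan_atLeast0 sum.atLeastLessThan_concat)
  also have "(\<Sum>c\<in>{N * n..<N * n + n}. g (c div n) (c mod n))
      = (\<Sum>r<n. g ((N * n + r) div n) ((N * n + r) mod n))"
    by (rule sum.reindex_bij_witness[of _ "\<lambda>r. N * n + r" "\<lambda>c. c - N * n"]) auto
  also have "\<dots> = (\<Sum>r<n. g N r)" by (rule sum.cong) auto
  finally show ?case using Suc by simp
qed simp

lemma kron_carrier:
  "X \<in> carrier_mat a b \<Longrightarrow> Y \<in> carrier_mat c d \<Longrightarrow> kron X Y \<in> carrier_mat (a * c) (b * d)"
  unfolding kron_def by auto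

lemma index_kron_mult_block_vec:
  assumes X: "X \<in> carrier_mat M N" and Y: "Y \<in> carrier_mat p n" and k: "k < M * p"
    and f: "\<And>j. j < N \<Longrightarrow> f j \<in> carrier_vec n"
  shows "(kron X Y *\<^sub>v block_vec N n f) $ k = (\<Sum>j<N. X $$ (k div p, j) * (Y *\<^sub>v f j) $ (k mod p))"
proof -
  have kp: "k div p < M" "k mod p < p" using block_index_bounds[OF k] .
  have dims: "dim_row (kron X Y) = M * p" "dim_col (kron X Y) = N * n"
    using kron_carrier[OF X Y] by auto
  have "(kron X Y *\<^sub>v block_vec N n f) $ k = (\<Sum>c<N * n. kron X Y $$ (k, c) * block_vec N n f $ c)"
    using k dims by (simp add: scalar_prod_def lessThan_atLeast0)
  also have "\<dots> = (\<Sum>c<N * n. (\<lambda>j r. X $$ (k div p, j) * (Y $$ (k mod p, r) * f j $ r)) (c div n) (c mod n))"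
  proof (rule sum.cong[OF refl])
    fix c assume "c \<in> {..<N * n}"
    then show "kron X Y $$ (k, c) * block_vec N n f $ c
        = (\<lambda>j r. X $$ (k div p, j) * (Y $$ (k mod p, r) * f j $ r)) (c div n) (c mod n)"
      using k X Y by (simp add: kron_def index_block_vec)
  qed
  also have "\<dots> = (\<Sum>j<N. \<Sum>r<n. X $$ (k div p, j) * (Y $$ (k mod p, r) * f j $ r))"
    by (rule sum_div_mod_lessThan)
  also have "\<dots> = (\<Sum>j<N. X $$ (k div p, j) * (Y *\<^sub>v f j) $ (k mod p))"
  proof (rule sum.cong[OF refl])
    fix j assume "j \<in> {..<N}"
    then have "(Y *\<^sub>v f j) $ (k mod p) = (\<Sum>r<n. Y $$ (k mod p, r) * f j $ r)"
      using Y kp f[of j] by (simp add: scalar_prod_def lessThan_atLeast0)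
    then show "(\<Sum>r<n. X $$ (k div p, j) * (Y $$ (k mod p, r) * f j $ r))
        = X $$ (k div p, j) * (Y *\<^sub>v f j) $ (k mod p)"
      by (simp add: sum_distrib_left)
  qed
  finally show ?thesis .
qed

lemma kron_one_mult_block_vec:
  assumes X: "X \<in> carrier_mat n n" and f: "\<And>j. j < N \<Longrightarrow> f j \<in> carrier_vec n"
  shows "kron (1\<^sub>m N) X *\<^sub>v block_vec N n f = block_vec N n (\<lambda>j. X *\<^sub>v f j)"
proof (rule eq_vecI)
  fix k assume "k < dim_vec (block_vec N n (\<lambda>j. X *\<^sub>v f j))"
  then have k: "k < N * n" by simp
  have kd: "k div n < N" using block_index_bounds(1)[OF k] .
  have "(kron (1\<^sub>m N) X *\<^sub>v block_vec N n f) $ k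
      = (\<Sum>j<N. 1\<^sub>m N $$ (k div n, j) * (X *\<^sub>v f j) $ (k mod n))"
    by (rule index_kron_mult_block_vec[OF one_carrier_mat X k f])
  also have "\<dots> = (\<Sum>j<N. if j = k div n then (X *\<^sub>v f j) $ (k mod n) else 0)"
    by (rule sum.cong) (auto simp: kd)
  also have "\<dots> = (X *\<^sub>v f (k div n)) $ (k mod n)" using kd by simp
  finally show "(kron (1\<^sub>m N) X *\<^sub>v block_vec N n f) $ k = block_vec N n (\<lambda>j. X *\<^sub>v f j) $ k"
    using k by (simp add: index_block_vec)
qed (use kron_carrier[OF one_carrier_mat[of N] X] in simp)

lemma kron_one_pow_mult_block_vec:
  assumes X: "X \<in> carrier_mat n n" and f: "\<And>j. j < N \<Longrightarrow> f j \<in> carrier_vec n"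
  shows "kron (1\<^sub>m N) X ^\<^sub>m k *\<^sub>v block_vec N n f = block_vec N n (\<lambda>j. X ^\<^sub>m k *\<^sub>v f j)"
  using f
proof (induction k arbitrary: f)
  case 0
  have "dim_row (kron (1\<^sub>m N) X) = N * n" using kron_carrier[OF one_carrier_mat[of N] X] by simp
  moreover have "block_vec N n (\<lambda>j. 1\<^sub>m (dim_row X) *\<^sub>v f j) = block_vec N n f"
    using X 0 by (intro block_vec_cong) auto
  ultimately show ?case by simp
next
  case (Suc k)
  let ?K = "kron (1\<^sub>m N) X"
  have K: "?K \<in> carrier_mat (N * n) (N * n)" by (rule kron_carrier[OF one_carrier_mat[of N] X])
  have "?K ^\<^sub>m Suc k *\<^sub>v block_vec N n f = ?K ^\<^sub>m k *\<^sub>v (?K *\<^sub>v block_vec N n f)"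
    using K by (simp add: assoc_mult_mat_vec[of _ "N * n" "N * n" _ "N * n"])
  also have "\<dots> = ?K ^\<^sub>m k *\<^sub>v block_vec N n (\<lambda>j. X *\<^sub>v f j)"
    by (simp add: kron_one_mult_block_vec[OF X Suc.prems])
  also have "\<dots> = block_vec N n (\<lambda>j. X ^\<^sub>m k *\<^sub>v (X *\<^sub>v f j))"
    by (rule Suc.IH) (use X Suc.prems in auto)
  also have "\<dots> = block_vec N n (\<lambda>j. X ^\<^sub>m Suc k *\<^sub>v f j)"
    using X Suc.prems by (intro block_vec_cong) (auto simp: assoc_mult_mat_vec[of _ n n _ n])
  finally show ?case .
qed

lemma kron_mult_block_vec_zero:
  assumes X: "X \<in> carrier_mat M N" and Y: "Y \<in> carrier_mat p n"
    and f: "\<And>j. j < N \<Longrightarrow> f j \<in> carrier_vec n" and zero: "\<And>j. j < N \<Longrightarrow> Y *\<^sub>v f j = 0\<^sub>v p"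
  shows "kron X Y *\<^sub>v block_vec N n f = 0\<^sub>v (M * p)"
proof (rule eq_vecI)
  fix k assume "k < dim_vec (0\<^sub>v (M * p) :: real vec)"
  then have k: "k < M * p" by simp
  have "(\<Sum>j<N. X $$ (k div p, j) * (Y *\<^sub>v f j) $ (k mod p)) = 0"
    using zero block_index_bounds(2)[OF k] by (intro sum.neutral) simp
  then show "(kron X Y *\<^sub>v block_vec N n f) $ k = 0\<^sub>v (M * p) $ k"
    using index_kron_mult_block_vec[OF X Y k f] k by simp
qed (use kron_carrier[OF X Y] in simp)

lemma kron_mult_block_vec_const:
  assumes X: "X \<in> carrier_mat M N" and Y: "Y \<in> carrier_mat p n" and y: "y \<in> carrier_vec n"
    and row_sums: "\<And>i. i < M \<Longrightarrow> (\<Sum>j<N. X $$ (i, j)) = 0"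
  shows "kron X Y *\<^sub>v block_vec N n (\<lambda>j. y) = 0\<^sub>v (M * p)"
proof (rule eq_vecI)
  fix k assume "k < dim_vec (0\<^sub>v (M * p) :: real vec)"
  then have k: "k < M * p" by simp
  have "(kron X Y *\<^sub>v block_vec N n (\<lambda>j. y)) $ k = (\<Sum>j<N. X $$ (k div p, j)) * (Y *\<^sub>v y) $ (k mod p)"
    using index_kron_mult_block_vec[OF X Y k] y by (simp add: sum_distrib_right)
  also have "\<dots> = 0" using row_sums block_index_bounds(1)[OF k] by simp
  finally show "(kron X Y *\<^sub>v block_vec N n (\<lambda>j. y)) $ k = 0\<^sub>v (M * p) $ k" using k by simp
qed (use kron_carrier[OF X Y] in simp)

lemma laplacian_carrier: "laplacian N E \<in> carrier_mat N N"
  unfolding laplacian_def adjacency_def by auto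

lemma laplacian_row_sum:
  assumes i: "i < N"
  shows "(\<Sum>j<N. laplacian N E $$ (i, j)) = 0"
proof -
  have "(\<Sum>j<N. laplacian N E $$ (i, j))
      = (\<Sum>j<N. (if i = j then real (in_degree N E j) else 0) - (if E j i then 1 else 0))"
    using i by (intro sum.cong) (auto simp: laplacian_def adjacency_def mat_diag_def)
  also have "\<dots> = real (in_degree N E i) - (\<Sum>j<N. if E j i then 1 else 0)"
    using i by (simp add: sum_subtractf)
  also have "(\<Sum>j<N. if E j i then 1 else 0) = real (card {j. j < N \<and> E j i})"
    by (simp add: sum.If_cases lessThan_def Collect_conj_eq Int_commute)
  finally show ?thesis by (simp add: in_degree_def)
qed

lemma diag_block_mat_carrier:
  assumes "\<forall>B\<in>set Bs. dim_col B = n"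
  shows "diag_block_mat Bs \<in> carrier_mat (sum_list (map dim_row Bs)) (length Bs * n)"
proof -
  have "sum_list (map dim_col Bs) = length Bs * n" using assms by (induction Bs) auto
  then show ?thesis unfolding carrier_mat_def using dim_diag_block_mat[of Bs] by simp
qed

lemma diag_block_mat_mult_block_vec_zero:
  assumes "\<forall>B\<in>set Bs. dim_col B = n"
    and "\<And>j. j < length Bs \<Longrightarrow> f j \<in> carrier_vec n"
    and "\<And>j. j < length Bs \<Longrightarrow> Bs ! j *\<^sub>v f j = 0\<^sub>v (dim_row (Bs ! j))"
  shows "diag_block_mat Bs *\<^sub>v block_vec (length Bs) n f = 0\<^sub>v (sum_list (map dim_row Bs))"
  using assms
proof (induction Bs arbitrary: f)
  case Nil
  show ?case by (intro eq_vecI) simp_all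
next
  case (Cons B Bs)
  let ?D = "diag_block_mat Bs" and ?g = "block_vec (length Bs) n (\<lambda>j. f (Suc j))"
  have D: "?D \<in> carrier_mat (sum_list (map dim_row Bs)) (length Bs * n)"
    using Cons.prems(1) by (intro diag_block_mat_carrier) simp
  have B: "B \<in> carrier_mat (dim_row B) n" using Cons.prems(1) unfolding carrier_mat_def by simp
  have f0: "f 0 \<in> carrier_vec n" using Cons.prems(2)[of 0] by simp
  have IH: "?D *\<^sub>v ?g = 0\<^sub>v (sum_list (map dim_row Bs))"
  proof (rule Cons.IH)
    show "\<forall>B\<in>set Bs. dim_col B = n" using Cons.prems(1) by simp
    fix j assume "j < length Bs"
    then show "f (Suc j) \<in> carrier_vec n" "Bs ! j *\<^sub>v f (Suc j) = 0\<^sub>v (dim_row (Bs ! j))"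
      using Cons.prems(2,3)[of "Suc j"] by simp_all
  qed
  have dims: "dim_col ?D = length Bs * n" "dim_row ?D = sum_list (map dim_row Bs)" "dim_col B = n"
    using D B by auto
  have "diag_block_mat (B # Bs) *\<^sub>v block_vec (length (B # Bs)) n f
     = four_block_mat B (0\<^sub>m (dim_row B) (dim_col ?D)) (0\<^sub>m (dim_row ?D) (dim_col B)) ?D
         *\<^sub>v (f 0 @\<^sub>v ?g)"
    using block_vec_Suc[of f n "length Bs", OF f0]
    by (simp only: diag_block_mat.simps Let_def length_Cons)
  also have "\<dots> = (B *\<^sub>v f 0 + 0\<^sub>m (dim_row B) (length Bs * n) *\<^sub>v ?g)
      @\<^sub>v (0\<^sub>m (sum_list (map dim_row Bs)) n *\<^sub>v f 0 + ?D *\<^sub>v ?g)"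
    unfolding dims by (rule four_block_mat_mult_vec[OF B zero_carrier_mat zero_carrier_mat D f0 block_vec_carrier])
  also have "\<dots> = 0\<^sub>v (sum_list (map dim_row (B # Bs)))"
    using Cons.prems(3)[of 0] IH f0 by simp
  finally show ?case .
qed

section \<open>Polynomials of block-diagonal matrices\<close>

definition mat_horner :: "real list \<Rightarrow> real mat \<Rightarrow> real mat" where
  "mat_horner cs F = foldr (\<lambda>c M. c \<cdot>\<^sub>m 1\<^sub>m (dim_row F) + F * M) cs (0\<^sub>m (dim_row F) (dim_row F))"

lemma poly_mat_eq_mat_horner: "poly_mat p F = mat_horner (coeffs p) F"
  unfolding poly_mat_def mat_horner_def ..

lemma mat_horner_Nil: "mat_horner [] F = 0\<^sub>m (dim_row F) (dim_row F)"
  unfolding mat_horner_def by simp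

lemma mat_horner_Cons: "mat_horner (c # cs) F = c \<cdot>\<^sub>m 1\<^sub>m (dim_row F) + F * mat_horner cs F"
  unfolding mat_horner_def by simp

lemma mat_horner_carrier: "F \<in> carrier_mat d d \<Longrightarrow> mat_horner cs F \<in> carrier_mat d d"
  by (induction cs) (auto simp: mat_horner_Nil mat_horner_Cons)

lemma poly_mat_carrier: "F \<in> carrier_mat d d \<Longrightarrow> poly_mat p F \<in> carrier_mat d d"
  unfolding poly_mat_eq_mat_horner by (rule mat_horner_carrier)

lemma mat_horner_kron_one_mult_block_vec:
  assumes X: "X \<in> carrier_mat n n" and f: "\<And>j. j < N \<Longrightarrow> f j \<in> carrier_vec n"
  shows "mat_horner cs (kron (1\<^sub>m N) X) *\<^sub>v block_vec N n f = block_vec N n (\<lambda>j. mat_horner cs X *\<^sub>v f j)"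
proof (induction cs)
  case Nil
  have "block_vec N n (\<lambda>j. mat_horner [] X *\<^sub>v f j) = block_vec N n (\<lambda>j. 0\<^sub>v n)"
    using X f by (intro block_vec_cong) (simp add: mat_horner_Nil)
  then show ?case using kron_carrier[OF one_carrier_mat[of N] X] by (simp add: mat_horner_Nil)
next
  case (Cons c cs)
  let ?K = "kron (1\<^sub>m N) X"
  have K: "?K \<in> carrier_mat (N * n) (N * n)" by (rule kron_carrier[OF one_carrier_mat[of N] X])
  have PK: "mat_horner cs ?K \<in> carrier_mat (N * n) (N * n)" by (rule mat_horner_carrier[OF K])
  have PX: "mat_horner cs X \<in> carrier_mat n n" by (rule mat_horner_carrier[OF X])
  have "mat_horner (c # cs) ?K *\<^sub>v block_vec N n f
      = c \<cdot>\<^sub>v block_vec N n f + ?K *\<^sub>v block_vec N n (\<lambda>j. mat_horner cs X *\<^sub>v f j)"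
    unfolding mat_horner_Cons using K PK
    by (simp add: add_mult_distrib_mat_vec[of _ "N * n" "N * n"] smult_one_mat_mult_vec Cons.IH)
  also have "\<dots> = block_vec N n (\<lambda>j. c \<cdot>\<^sub>v f j + X *\<^sub>v (mat_horner cs X *\<^sub>v f j))"
    using X PX f by (simp add: kron_one_mult_block_vec block_vec_add_smult)
  also have "\<dots> = block_vec N n (\<lambda>j. mat_horner (c # cs) X *\<^sub>v f j)"
    unfolding mat_horner_Cons using X PX f
    by (intro block_vec_cong) (simp add: add_mult_distrib_mat_vec[of _ n n] smult_one_mat_mult_vec)
  finally show ?case .
qed

lemma mat_horner_kron_one_eq_zero_iff:
  assumes N: "N \<ge> 1" and X: "X \<in> carrier_mat n n"
  shows "mat_horner cs (kron (1\<^sub>m N) X) = 0\<^sub>m (N * n) (N * n) \<longleftrightarrow> mat_horner cs X = 0\<^sub>m n n"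
proof -
  let ?P = "mat_horner cs X"
  have K: "kron (1\<^sub>m N) X \<in> carrier_mat (N * n) (N * n)" by (rule kron_carrier[OF one_carrier_mat[of N] X])
  have P: "?P \<in> carrier_mat n n" by (rule mat_horner_carrier[OF X])
  have blocks: "mat_horner cs (kron (1\<^sub>m N) X) *\<^sub>v block_vec N n f = 0\<^sub>v (N * n) \<longleftrightarrow> (\<forall>j<N. ?P *\<^sub>v f j = 0\<^sub>v n)"
    if "\<And>j. j < N \<Longrightarrow> f j \<in> carrier_vec n" for f
    using that P by (simp add: mat_horner_kron_one_mult_block_vec[OF X] block_vec_eq_zero_iff)
  show ?thesis
  proof
    assume "mat_horner cs (kron (1\<^sub>m N) X) = 0\<^sub>m (N * n) (N * n)"
    then have "\<forall>j<N. ?P *\<^sub>v v = 0\<^sub>v n" if "v \<in> carrier_vec n" for v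
      using blocks[of "\<lambda>j. v"] K that by simp
    moreover have "0 < N" using N by simp
    ultimately have "\<forall>v\<in>carrier_vec n. ?P *\<^sub>v v = 0\<^sub>v n" by blast
    then show "?P = 0\<^sub>m n n" using mat_eq_zero_iff_mult_vec[OF P] by simp
  next
    assume "?P = 0\<^sub>m n n"
    then have "mat_horner cs (kron (1\<^sub>m N) X) *\<^sub>v v = 0\<^sub>v (N * n)" if "v \<in> carrier_vec (N * n)" for v
      using blocks[of "\<lambda>j. vec n (\<lambda>r. v $ (j * n + r))"] block_vec_blocks[OF that] by simp
    then show "mat_horner cs (kron (1\<^sub>m N) X) = 0\<^sub>m (N * n) (N * n)"
      using mat_eq_zero_iff_mult_vec[OF mat_horner_carrier[OF K]] by simp
  qed
qed

lemma min_poly_kron_one: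
  assumes N: "N \<ge> 1" and X: "X \<in> carrier_mat n n"
  shows "min_poly (kron (1\<^sub>m N) X) = min_poly X"
proof -
  have "kron (1\<^sub>m N) X \<in> carrier_mat (N * n) (N * n)" by (rule kron_carrier[OF one_carrier_mat[of N] X])
  with X mat_horner_kron_one_eq_zero_iff[OF N X] show ?thesis
    unfolding min_poly_def poly_mat_eq_mat_horner by simp
qed

lemma min_poly_plus_kron_one:
  "N \<ge> 1 \<Longrightarrow> X \<in> carrier_mat n n \<Longrightarrow> min_poly_plus (kron (1\<^sub>m N) X) = min_poly_plus X"
  unfolding min_poly_plus_def by (simp add: min_poly_kron_one)

section \<open>Unobservable and undetectable subspaces\<close>

lemma unobservable_subspace_eq_krylov_kernel:
  assumes A: "A \<in> carrier_mat n n" and B: "B \<in> carrier_mat q n"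
  shows "unobservable_subspace B A = krylov_kernel n B A n"
proof -
  have ker: "mat_kernel (B * A ^\<^sub>m k) = {x \<in> carrier_vec n. B *\<^sub>v (A ^\<^sub>m k *\<^sub>v x) = 0\<^sub>v q}" for k
    using mat_kernel[OF mult_carrier_mat[OF B pow_carrier_mat[OF A]], of k]
      mult_pow_mat_mult_vec[OF A B] by auto
  have shift: "(\<Inter>l\<in>{1..n}. mat_kernel (B * A ^\<^sub>m (l - 1))) = (\<Inter>k\<in>{..<n}. mat_kernel (B * A ^\<^sub>m k))"
    unfolding image_Suc_lessThan[symmetric] by simp
  have dim: "dim_row A = n" using A by simp
  show ?thesis
    unfolding unobservable_subspace_def dim shift using B by (auto simp: ker krylov_kernel_def)
qed

lemma unobservable_subspace_iff:
  assumes A: "A \<in> carrier_mat n n" and B: "B \<in> carrier_mat q n"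
  shows "x \<in> unobservable_subspace B A \<longleftrightarrow> x \<in> carrier_vec n \<and> (\<forall>k. B *\<^sub>v (A ^\<^sub>m k *\<^sub>v x) = 0\<^sub>v q)"
proof
  assume "x \<in> unobservable_subspace B A"
  then have "x \<in> krylov_kernel n B A (Suc k)" for k
    using krylov_kernel_dim_subset[OF A B] unfolding unobservable_subspace_eq_krylov_kernel[OF A B]
    by blast
  then show "x \<in> carrier_vec n \<and> (\<forall>k. B *\<^sub>v (A ^\<^sub>m k *\<^sub>v x) = 0\<^sub>v q)"
    using B unfolding krylov_kernel_def by auto
next
  assume "x \<in> carrier_vec n \<and> (\<forall>k. B *\<^sub>v (A ^\<^sub>m k *\<^sub>v x) = 0\<^sub>v q)"
  then show "x \<in> unobservable_subspace B A"
    using B unfolding unobservable_subspace_eq_krylov_kernel[OF A B] krylov_kernel_def by auto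
qed

lemma undetectable_subspace_eq:
  "undetectable_subspace G F = unobservable_subspace G F \<inter> mat_kernel (poly_mat (min_poly_plus F) F)"
  unfolding undetectable_subspace_def unobservable_subspace_def by blast

lemma undetectable_subspace_iff:
  assumes A: "A \<in> carrier_mat n n" and B: "B \<in> carrier_mat q n"
  shows "x \<in> undetectable_subspace B A \<longleftrightarrow> x \<in> carrier_vec n \<and> (\<forall>k. B *\<^sub>v (A ^\<^sub>m k *\<^sub>v x) = 0\<^sub>v q)
           \<and> poly_mat (min_poly_plus A) A *\<^sub>v x = 0\<^sub>v n"
  using poly_mat_carrier[OF A, of "min_poly_plus A"]
  by (auto simp: undetectable_subspace_eq unobservable_subspace_iff[OF A B] mat_kernel_def)

lemma zero_in_undetectable_subspace:
  assumes A: "A \<in> carrier_mat n n" and B: "B \<in> carrier_mat q n"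
  shows "0\<^sub>v n \<in> undetectable_subspace B A"
  using mult_mat_vec_zero[OF pow_carrier_mat[OF A]] mult_mat_vec_zero[OF B]
    mult_mat_vec_zero[OF poly_mat_carrier[OF A]]
  by (simp add: undetectable_subspace_iff[OF A B])

lemma undetectable_subspace_subspace:
  assumes A: "A \<in> carrier_mat n n" and B: "B \<in> carrier_mat q n"
  shows "subspace class_ring (undetectable_subspace B A) (module_vec TYPE(real) n)"
proof -
  let ?P = "poly_mat (min_poly_plus A) A"
  have P: "?P \<in> carrier_mat n n" by (rule poly_mat_carrier[OF A])
  have "undetectable_subspace B A =
      {v \<in> carrier_vec n. \<forall>M\<in>insert ?P (range (\<lambda>k. B * A ^\<^sub>m k)). M *\<^sub>v v = 0\<^sub>v (dim_row M)}"
    using A B P by (auto simp: undetectable_subspace_iff[OF A B] mult_pow_mat_mult_vec[OF A B])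
  then show ?thesis using common_kernel_subspace[of "insert ?P (range (\<lambda>k. B * A ^\<^sub>m k))" n] A B P
    by simp
qed

lemma stacked_rows_carrier:
  assumes "\<And>l. l \<in> set ls \<Longrightarrow> G l \<in> carrier_mat p n"
  shows "foldr (\<lambda>l M. G l @\<^sub>r M) ls (0\<^sub>m 0 n) \<in> carrier_mat (length ls * p) n"
  using assms by (induction ls) auto

lemma stacked_rows_mult_vec_eq_zero_iff:
  fixes G :: "nat \<Rightarrow> real mat"
  assumes G: "\<And>l. l \<in> set ls \<Longrightarrow> G l \<in> carrier_mat p n" and x: "x \<in> carrier_vec n"
  shows "foldr (\<lambda>l M. G l @\<^sub>r M) ls (0\<^sub>m 0 n) *\<^sub>v x = 0\<^sub>v (length ls * p)
           \<longleftrightarrow> (\<forall>l\<in>set ls. G l *\<^sub>v x = 0\<^sub>v p)"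
  using G
proof (induction ls)
  case (Cons l ls)
  let ?F = "foldr (\<lambda>l M. G l @\<^sub>r M) ls (0\<^sub>m 0 n)"
  have Gl: "G l \<in> carrier_mat p n" and F: "?F \<in> carrier_mat (length ls * p) n"
    using Cons.prems stacked_rows_carrier[of ls G p n] by auto
  have split: "foldr (\<lambda>l M. G l @\<^sub>r M) (l # ls) (0\<^sub>m 0 n) *\<^sub>v x = G l *\<^sub>v x @\<^sub>v ?F *\<^sub>v x"
    by (simp add: mat_mult_append[OF Gl F x])
  have zero: "0\<^sub>v (length (l # ls) * p) = (0\<^sub>v p :: real vec) @\<^sub>v 0\<^sub>v (length ls * p)"
    by simp
  have IH: "?F *\<^sub>v x = 0\<^sub>v (length ls * p) \<longleftrightarrow> (\<forall>l\<in>set ls. G l *\<^sub>v x = 0\<^sub>v p)"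
    using Cons by simp
  show ?case
    unfolding split zero append_vec_eq[OF mult_mat_vec_carrier[OF Gl x] zero_carrier_vec] IH by simp
qed (simp add: x)

lemma obs_matrix_carrier:
  assumes A: "A \<in> carrier_mat n n" and H: "H \<in> carrier_mat p n"
  shows "obs_matrix H A \<in> carrier_mat (n * p) n"
  using stacked_rows_carrier[of "[0..<n]" "\<lambda>l. H * A ^\<^sub>m l" p n] A H
  unfolding obs_matrix_def by auto

lemma obs_matrix_kernel:
  assumes A: "A \<in> carrier_mat n n" and H: "H \<in> carrier_mat p n" and x: "x \<in> carrier_vec n"
  shows "obs_matrix H A *\<^sub>v x = 0\<^sub>v (n * p) \<longleftrightarrow> x \<in> unobservable_subspace H A"
  using stacked_rows_mult_vec_eq_zero_iff[of "[0..<n]" "\<lambda>l. H * A ^\<^sub>m l" p n x] A H x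
  unfolding obs_matrix_def unobservable_subspace_eq_krylov_kernel[OF A H] krylov_kernel_def
  by (auto simp: mult_pow_mat_mult_vec[OF A H])

lemma subspace_dim_le_obs_matrix_rank:
  assumes A: "A \<in> carrier_mat n n" and H: "H \<in> carrier_mat p n"
    and W: "subspace class_ring W (module_vec TYPE(real) n)"
    and disjoint: "unobservable_subspace H A \<inter> W = {0\<^sub>v n}"
  shows "subspace_dim n W \<le> mat_rank (obs_matrix H A)"
proof (rule subspace_dim_le_rank[OF obs_matrix_carrier[OF A H] W])
  show "\<forall>x\<in>W. obs_matrix H A *\<^sub>v x = 0\<^sub>v (n * p) \<longrightarrow> x = 0\<^sub>v n"
    using disjoint obs_matrix_kernel[OF A H] subspace_carrier_vec[OF W] by blast
qed

section \<open>Networks with zero-row-sum coupling\<close>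

locale network_detectable =
  fixes N n p :: nat and m :: "nat \<Rightarrow> nat" and L A H :: "real mat" and C :: "nat \<Rightarrow> real mat"
  assumes N: "N \<ge> 1"
    and L: "L \<in> carrier_mat N N"
    and L_row_sums: "\<And>i. i < N \<Longrightarrow> (\<Sum>j<N. L $$ (i, j)) = 0"
    and A: "A \<in> carrier_mat n n"
    and C: "\<And>i. i < N \<Longrightarrow> C i \<in> carrier_mat (m i) n"
    and H: "H \<in> carrier_mat p n"
    and detectable: "detectable (diag_block_mat (map C [0..<N]) @\<^sub>r kron L H) (kron (1\<^sub>m N) A)"
begin

lemma block_vec_in_undetectable_subspace:
  assumes f: "\<And>j. j < N \<Longrightarrow> f j \<in> undetectable_subspace (C j) A"
    and L_zero: "\<And>k. kron L H *\<^sub>v block_vec N n (\<lambda>j. A ^\<^sub>m k *\<^sub>v f j) = 0\<^sub>v (N * p)"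
  shows "block_vec N n f \<in> undetectable_subspace (diag_block_mat (map C [0..<N]) @\<^sub>r kron L H) (kron (1\<^sub>m N) A)"
proof -
  let ?K = "kron (1\<^sub>m N) A" and ?D = "diag_block_mat (map C [0..<N])"
  let ?R = "sum_list (map dim_row (map C [0..<N]))"
  have K: "?K \<in> carrier_mat (N * n) (N * n)" by (rule kron_carrier[OF one_carrier_mat[of N] A])
  have Cdim: "dim_row (C j) = m j" "dim_col (C j) = n" if "j < N" for j
    using C[OF that] by auto
  have D: "?D \<in> carrier_mat ?R (N * n)"
    using diag_block_mat_carrier[of "map C [0..<N]" n] Cdim by simp
  have LH: "kron L H \<in> carrier_mat (N * p) (N * n)" by (rule kron_carrier[OF L H])
  have fC: "f j \<in> carrier_vec n" "\<And>k. C j *\<^sub>v (A ^\<^sub>m k *\<^sub>v f j) = 0\<^sub>v (m j)"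
    "poly_mat (min_poly_plus A) A *\<^sub>v f j = 0\<^sub>v n" if "j < N" for j
    using f[OF that] undetectable_subspace_iff[OF A C[OF that]] by auto
  have fk: "A ^\<^sub>m k *\<^sub>v f j \<in> carrier_vec n" if "j < N" for j k
    using mult_mat_vec_carrier[OF pow_carrier_mat[OF A] fC(1)[OF that]] .
  have "(?D @\<^sub>r kron L H) *\<^sub>v (?K ^\<^sub>m k *\<^sub>v block_vec N n f) = 0\<^sub>v (?R + N * p)" for k
  proof -
    have "?D *\<^sub>v block_vec N n (\<lambda>j. A ^\<^sub>m k *\<^sub>v f j) = 0\<^sub>v ?R"
      using diag_block_mat_mult_block_vec_zero[of "map C [0..<N]" n "\<lambda>j. A ^\<^sub>m k *\<^sub>v f j"] Cdim fk fC(2)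
      by simp
    then show ?thesis
      using L_zero[of k] fC(1) by (simp add: kron_one_pow_mult_block_vec[OF A] mat_mult_append[OF D LH])
  qed
  moreover have "poly_mat (min_poly_plus ?K) ?K *\<^sub>v block_vec N n f = 0\<^sub>v (N * n)"
    using fC(1,3) mat_horner_kron_one_mult_block_vec[OF A]
    by (simp add: min_poly_plus_kron_one[OF N A] poly_mat_eq_mat_horner block_vec_eq_zero_iff)
  ultimately show ?thesis
    using undetectable_subspace_iff[OF K carrier_append_rows[OF D LH]] by simp
qed

lemma block_vec_eq_zero:
  assumes "\<And>j. j < N \<Longrightarrow> f j \<in> undetectable_subspace (C j) A"
    and "\<And>k. kron L H *\<^sub>v block_vec N n (\<lambda>j. A ^\<^sub>m k *\<^sub>v f j) = 0\<^sub>v (N * p)"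
  shows "block_vec N n f = 0\<^sub>v (N * n)"
  using block_vec_in_undetectable_subspace[OF assms] detectable kron_carrier[OF one_carrier_mat[of N] A]
  unfolding detectable_def by simp

lemma inter_undetectable_subspaces:
  "(\<Inter>i\<in>{..<N}. undetectable_subspace (C i) A) = {0\<^sub>v n}"
proof
  show "(\<Inter>i\<in>{..<N}. undetectable_subspace (C i) A) \<subseteq> {0\<^sub>v n}"
  proof
    fix x assume x: "x \<in> (\<Inter>i\<in>{..<N}. undetectable_subspace (C i) A)"
    have "x \<in> undetectable_subspace (C 0) A" using x N by auto
    then have xC: "x \<in> carrier_vec n" using undetectable_subspace_iff[OF A C] N by auto
    have "block_vec N n (\<lambda>j. x) = 0\<^sub>v (N * n)"
      using x kron_mult_block_vec_const[OF L H _ L_row_sums]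
        mult_mat_vec_carrier[OF pow_carrier_mat[OF A] xC]
      by (intro block_vec_eq_zero) auto
    then show "x \<in> {0\<^sub>v n}" using N xC by (auto simp: block_vec_eq_zero_iff Suc_le_eq)
  qed
  show "{0\<^sub>v n} \<subseteq> (\<Inter>i\<in>{..<N}. undetectable_subspace (C i) A)"
    using zero_in_undetectable_subspace[OF A C] by auto
qed

lemma unobservable_inter_undetectable_subspace:
  assumes i: "i < N"
  shows "unobservable_subspace H A \<inter> undetectable_subspace (C i) A = {0\<^sub>v n}"
proof
  show "unobservable_subspace H A \<inter> undetectable_subspace (C i) A \<subseteq> {0\<^sub>v n}"
  proof
    fix x assume x: "x \<in> unobservable_subspace H A \<inter> undetectable_subspace (C i) A"
    let ?f = "\<lambda>j. if j = i then x else 0\<^sub>v n"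
    have xC: "x \<in> carrier_vec n" and Hx: "\<And>k. H *\<^sub>v (A ^\<^sub>m k *\<^sub>v x) = 0\<^sub>v p"
      using x unobservable_subspace_iff[OF A H] by auto
    have "block_vec N n ?f = 0\<^sub>v (N * n)"
    proof (rule block_vec_eq_zero)
      show "?f j \<in> undetectable_subspace (C j) A" if "j < N" for j
        using x zero_in_undetectable_subspace[OF A C[OF that]] by auto
      show "kron L H *\<^sub>v block_vec N n (\<lambda>j. A ^\<^sub>m k *\<^sub>v ?f j) = 0\<^sub>v (N * p)" for k
        using Hx xC mult_mat_vec_carrier[OF pow_carrier_mat[OF A]] mult_mat_vec_zero[OF H]
          mult_mat_vec_zero[OF pow_carrier_mat[OF A]]
        by (intro kron_mult_block_vec_zero[OF L H]) auto
    qed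
    then show "x \<in> {0\<^sub>v n}" using i xC by (auto simp: block_vec_eq_zero_iff)
  qed
  show "{0\<^sub>v n} \<subseteq> unobservable_subspace H A \<inter> undetectable_subspace (C i) A"
    using zero_in_undetectable_subspace[OF A C[OF i]] mult_mat_vec_zero[OF H]
      mult_mat_vec_zero[OF pow_carrier_mat[OF A]]
    by (simp add: unobservable_subspace_iff[OF A H])
qed

lemma undetectable_subspace_dim_le_obs_matrix_rank:
  "i < N \<Longrightarrow> subspace_dim n (undetectable_subspace (C i) A) \<le> mat_rank (obs_matrix H A)"
  using subspace_dim_le_obs_matrix_rank[OF A H undetectable_subspace_subspace[OF A C]]
    unobservable_inter_undetectable_subspace by simp

end

theorem theorem1:
  fixes N n p :: nat and m :: "nat \<Rightarrow> nat" and E :: "nat \<Rightarrow> nat \<Rightarrow> bool"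
    and A H :: "real mat" and C :: "nat \<Rightarrow> real mat"
  assumes N: "N \<ge> 1"
    and no_loops: "\<forall>i<N. \<not> E i i"
    and A: "A \<in> carrier_mat n n"
    and C: "\<forall>i<N. C i \<in> carrier_mat (m i) n"
    and H: "H \<in> carrier_mat p n"
    and det: "detectable
               (diag_block_mat (map C [0..<N]) @\<^sub>r kron (laplacian N E) H)
               (kron (1\<^sub>m N) A)"
  shows "(\<Inter>i\<in>{..<N}. undetectable_subspace (C i) A) = {0\<^sub>v n} \<and>
         (\<forall>i<N. unobservable_subspace H A \<inter> undetectable_subspace (C i) A = {0\<^sub>v n}) \<and>
         mat_rank (obs_matrix H A) \<ge> Max ((\<lambda>i. subspace_dim n (undetectable_subspace (C i) A)) ` {..<N})"
proof -
  interpret network_detectable N n p m "laplacian N E" A H C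
    using N A C H det by unfold_locales (auto simp: laplacian_carrier laplacian_row_sum)
  have "Max ((\<lambda>i. subspace_dim n (undetectable_subspace (C i) A)) ` {..<N}) \<le> mat_rank (obs_matrix H A)"
    using N undetectable_subspace_dim_le_obs_matrix_rank by (subst Max_le_iff) (auto simp: Suc_le_eq)
  then show ?thesis
    using inter_undetectable_subspaces unobservable_inter_undetectable_subspace by blast
qed

end
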